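(* Let $q$ be a prime power and let $n,k,d$ be integers with $1\le k\le n$ and $d\ge 1$. If $$\sum_{i=1}^{d-1}\binom{n}{i}(q^2-1)^i<\frac{\prod_{i=0}^{k-1}(q^{2n-2i}-1)}{k\prod_{i=0}^{k-1}(q^{2n-2i-1}-1)},$$ then there exists a symplectic self-orthogonal $\mathbb{F}_q$-linear code $C\subseteq\mathbb{F}_q^{2n}$ of dimension $k$ such that $d_S(C^{\perp_S})\ge d$.
   Context: Let $\mathbb{F}_q$ be the finite field with $q$ elements. Vectors of $\mathbb{F}_q^{2n}$ are written $(\mathbf{a}|\mathbf{b})$ with $\mathbf{a},\mathbf{b}\in\mathbb{F}_q^n$. The symplectic inner product is $\langle(\mathbf{a}|\mathbf{b}),(\mathbf{a}'|\mathbf{b}')\rangle_S=\langle\mathbf{a},\mathbf{b}'\rangle_E-\langle\mathbf{b},\mathbf{a}'\rangle_E$, where $\langle\cdot,\cdot\rangle_E$ is the ordinary dot product on $\mathbb{F}_q^n$. For an $\mathbb{F}_q$-linear code (subspace) $C\subseteq\mathbb{F}_q^{2n}$, the symplectic dual is $C^{\perp_S}=\{(\mathbf{x}|\mathbf{y})\in\mathbb{F}_q^{2n}: \langle(\mathbf{x}|\mathbf{y}),(\mathbf{a}|\mathbf{b})\rangle_S=0 \text{ for all } (\mathbf{a}|\mathbf{b})\in C\}$, and $C$ is symplectic self-orthogonal if $C\subseteq C^{\perp_S}$. The symplectic weight of $(\mathbf{a}|\mathbf{b})=(a_1,\dots,a_n|b_1,\dots,b_n)$ is $\mathrm{wt}_S(\mathbf{a}|\mathbf{b})=|\{i\in\{1,\dots,n\}:(a_i,b_i)\ne(0,0)\}|$,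 and the symplectic minimum distance of a nonzero linear code $D\subseteq\mathbb{F}_q^{2n}$ is $d_S(D)=\min\{\mathrm{wt}_S(\mathbf{a}|\mathbf{b}):(\mathbf{a}|\mathbf{b})\in D\setminus\{(\mathbf{0}|\mathbf{0})\}\}$. *)

theory Defs
  imports "HOL-Analysis.Analysis"
begin

text \<open>
  A vector \<open>(a|b)\<close> of \<open>F\<^sup>2\<^sup>n\<close> has its coordinates indexed by the sum type \<open>'n + 'n\<close>, where
  \<open>CARD('n) = n\<close>: \<open>a\<close> occupies the coordinates \<open>Inl i\<close> and \<open>b\<close> the coordinates \<open>Inr i\<close>.
  This makes \<^const>\<open>vec.subspace\<close> and \<^const>\<open>vec.dim\<close> directly available for linear codes.
\<close>

definition left_half :: "'a ^ ('n::finite + 'n) \<Rightarrow> 'a ^ 'n" where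
  "left_half v = (\<chi> i. v $ Inl i)"

definition right_half :: "'a ^ ('n::finite + 'n) \<Rightarrow> 'a ^ 'n" where
  "right_half v = (\<chi> i. v $ Inr i)"

definition symp_prod :: "'a::comm_ring_1 ^ ('n::finite + 'n) \<Rightarrow> 'a ^ ('n + 'n) \<Rightarrow> 'a" where
  "symp_prod v w =
     scalar_product (left_half v) (right_half w) - scalar_product (right_half v) (left_half w)"

definition symp_dual :: "('a::comm_ring_1 ^ ('n::finite + 'n)) set \<Rightarrow> ('a ^ ('n + 'n)) set" where
  "symp_dual C = {v. \<forall>c\<in>C. symp_prod v c = 0}"

definition symp_self_orthogonal :: "('a::comm_ring_1 ^ ('n::finite + 'n)) set \<Rightarrow> bool" where
  "symp_self_orthogonal C \<longleftrightarrow> C \<subseteq> symp_dual C"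

definition symp_weight :: "'a::zero ^ ('n::finite + 'n) \<Rightarrow> nat" where
  "symp_weight v = card {i. (left_half v $ i, right_half v $ i) \<noteq> (0, 0)}"

text \<open>Only meaningful for \<open>D\<close> with a nonzero element (\<^const>\<open>Min\<close> of the empty set is unspecified).\<close>

definition symp_min_dist :: "('a::zero ^ ('n::finite + 'n)) set \<Rightarrow> nat" where
  "symp_min_dist D = Min (symp_weight ` (D - {0}))"

end

theory Submission imports Defs begin

text \<open>
  Average over the family of all \<open>k\<close>-dimensional self-orthogonal codes \<open>C\<close> with
  \<open>|C\<^sup>\<bottom>| = q\<^sup>2\<^sup>n\<^sup>-\<^sup>k\<close>. Symplectic transvections act transitively on the nonzero vectors and permute
  this family, so every nonzero vector lies in the same number of duals, namely in a fraction
  \<open>(q\<^sup>2\<^sup>n\<^sup>-\<^sup>k - 1) / (q\<^sup>2\<^sup>n - 1)\<close> of them. If fewer than \<open>(q\<^sup>2\<^sup>n - 1) / (q\<^sup>2\<^sup>n\<^sup>-\<^sup>k - 1)\<close> nonzero vectors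
  have weight below \<open>d\<close>, some dual contains none of them. The assumed bound is at most this
  quotient.
\<close>

section \<open>Bilinearity and nondegeneracy of the symplectic form\<close>

lemma symp_prod_alt:
  "symp_prod v w = (\<Sum>i\<in>UNIV. v $ Inl i * w $ Inr i) - (\<Sum>i\<in>UNIV. v $ Inr i * w $ Inl i)"
  by (simp add: symp_prod_def left_half_def right_half_def scalar_product_def)

lemma symp_prod_add_left: "symp_prod (u + v) w = symp_prod u w + symp_prod v w"
  by (simp add: symp_prod_alt distrib_right sum.distrib)

lemma symp_prod_scale_left: "symp_prod (c *s v) w = c * symp_prod v w"
  by (simp add: symp_prod_alt sum_distrib_left right_diff_distrib mult.assoc)

lemma symp_prod_flip: "symp_prod v w = - symp_prod w v"
  by (simp add: symp_prod_alt mult.commute)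

lemma symp_prod_self [simp]: "symp_prod v v = 0"
  by (simp add: symp_prod_alt mult.commute)

lemma symp_prod_add_right: "symp_prod w (u + v) = symp_prod w u + symp_prod w v"
  by (metis add.commute minus_add symp_prod_add_left symp_prod_flip)

lemma symp_prod_scale_right: "symp_prod w (c *s v) = c * symp_prod w v"
  by (metis mult_minus_right symp_prod_flip symp_prod_scale_left)

lemma symp_prod_diff_left: "symp_prod (u - v) w = symp_prod u w - symp_prod v w"
  by (metis add_diff_cancel diff_add_cancel symp_prod_add_left)

lemma symp_prod_diff_right: "symp_prod w (u - v) = symp_prod w u - symp_prod w v"
  by (metis add_diff_cancel diff_add_cancel symp_prod_add_right)

lemma symp_prod_zero_left [simp]: "symp_prod 0 v = 0"
  by (simp add: symp_prod_alt)

lemma symp_prod_axis_Inl: "symp_prod v (axis (Inl i) 1) = - v $ Inr i"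
proof -
  have "symp_prod v (axis (Inl i) 1) = - (\<Sum>j\<in>UNIV. if j = i then v $ Inr j else 0)"
    by (simp add: symp_prod_alt axis_def if_distrib cong: if_cong)
  then show ?thesis by simp
qed

lemma symp_prod_axis_Inr: "symp_prod v (axis (Inr i) 1) = v $ Inl i"
proof -
  have "symp_prod v (axis (Inr i) 1) = (\<Sum>j\<in>UNIV. if j = i then v $ Inl j else 0)"
    by (simp add: symp_prod_alt axis_def if_distrib cong: if_cong)
  then show ?thesis by simp
qed

lemma symp_prod_nondegenerate:
  assumes "\<And>w. symp_prod v w = 0"
  shows "v = 0"
proof -
  \<comment> \<open>Pairing with unit vectors reads off coordinates up to sign. For each shape of
    \<open>j\<close> only one of the two instances is used; in the other, \<open>projl\<close> or
    \<open>projr\<close> is unspecified.\<close>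
  have "v $ j = 0" for j
    using assms[of "axis (Inl (projr j)) 1"] assms[of "axis (Inr (projl j)) 1"]
    by (cases j) (simp_all add: symp_prod_axis_Inl symp_prod_axis_Inr)
  then show ?thesis by (simp add: vec_eq_iff)
qed

section \<open>Symplectic maps and their transitivity on nonzero vectors\<close>

definition symp_map :: "('a::field ^ ('n::finite + 'n) \<Rightarrow> 'a ^ ('n + 'n)) \<Rightarrow> bool" where
  "symp_map f \<longleftrightarrow> Vector_Spaces.linear (*s) (*s) f \<and> (\<forall>x y. symp_prod (f x) (f y) = symp_prod x y)"

lemma symp_map_comp: "symp_map f \<Longrightarrow> symp_map g \<Longrightarrow> symp_map (g \<circ> f)"
  by (auto simp: symp_map_def intro: Vector_Spaces.linear_compose)

lemma symp_map_inj:
  assumes "symp_map f"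
  shows "inj f"
proof (rule injI)
  fix x y assume eq: "f x = f y"
  have "symp_prod (x - y) z = 0" for z
    using assms eq unfolding symp_map_def by (metis right_minus_eq symp_prod_diff_left)
  then show "x = y" using symp_prod_nondegenerate[of "x - y"] by auto
qed

lemma symp_dual_image:
  assumes f: "symp_map f" and "surj f"
  shows "symp_dual (f ` C) = f ` symp_dual C"
  using assms by (auto simp: symp_dual_def symp_map_def image_iff) (metis surjD)

text \<open>The two cross terms cancel because the form is antisymmetric, and the quadratic term
  vanishes because \<open>symp_prod u u = 0\<close>.\<close>

lemma symp_map_transvection: "symp_map (\<lambda>x. x + (c * symp_prod x u) *s u)"
proof -
  have "Vector_Spaces.linear (*s) (*s) (\<lambda>x. x + (c * symp_prod x u) *s u)"
    by unfold_locales
      (simp_all add: symp_prod_add_left symp_prod_scale_left vec_eq_iff algebra_simps)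
  moreover have "symp_prod (x + (c * symp_prod x u) *s u) (y + (c * symp_prod y u) *s u)
      = symp_prod x y" for x y
    using symp_prod_flip[of u y]
    by (simp add: symp_prod_add_left symp_prod_add_right symp_prod_scale_left
        symp_prod_scale_right)
  ultimately show ?thesis by (simp add: symp_map_def)
qed

lemma ex_symp_map_not_orthogonal:
  fixes w w' :: "'a::field ^ ('n::finite + 'n)"
  assumes "symp_prod w w' \<noteq> 0"
  shows "\<exists>f. symp_map f \<and> f w = w'"
proof -
  \<comment> \<open>Since \<open>symp_prod w w = 0\<close>, pairing \<open>w\<close> with
    \<open>w' - w\<close> gives \<open>symp_prod w w'\<close>; this \<open>c\<close> makes the
    transvection add exactly \<open>w' - w\<close>.\<close>
  define c where "c = 1 / symp_prod w w'"
  have "w + (c * symp_prod w (w' - w)) *s (w' - w) = w'"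
    using assms by (simp add: c_def symp_prod_diff_right)
  then show ?thesis using symp_map_transvection[of c "w' - w"] by blast
qed

text \<open>Orthogonal vectors are joined in two transvections through some \<open>z\<close>
  orthogonal to neither. If neither \<open>a\<close> nor \<open>b\<close> can serve as
  \<open>z\<close>, then \<open>a + b\<close> can.\<close>

lemma ex_symp_map:
  fixes w w' :: "'a::field ^ ('n::finite + 'n)"
  assumes "w \<noteq> 0" "w' \<noteq> 0"
  shows "\<exists>f. symp_map f \<and> f w = w'"
proof -
  obtain a b where ab: "symp_prod w a \<noteq> 0" "symp_prod w' b \<noteq> 0"
    using assms symp_prod_nondegenerate by metis
  have "\<exists>z. symp_prod w z \<noteq> 0 \<and> symp_prod w' z \<noteq> 0"
  proof (cases "symp_prod w' a = 0 \<and> symp_prod w b = 0")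
    case True
    then show ?thesis using ab by (intro exI[of _ "a + b"]) (simp add: symp_prod_add_right)
  qed (use ab in blast)
  then obtain z where z: "symp_prod w z \<noteq> 0" "symp_prod w' z \<noteq> 0" by blast
  then have "symp_prod z w' \<noteq> 0" using symp_prod_flip[of z w'] by simp
  with z obtain f g where "symp_map f" "f w = z" "symp_map g" "g z = w'"
    using ex_symp_map_not_orthogonal by metis
  then show ?thesis using symp_map_comp[of f g] by (intro exI[of _ "g \<circ> f"]) simp
qed

section \<open>Double counting of codes and vectors in their duals\<close>

text \<open>Fixing the size of the dual inside the family spares a dimension formula for duals: the
  counting below needs only this size and one explicit member.\<close>

definition isotropic_codes :: "nat \<Rightarrow> nat \<Rightarrow> ('a::{field,finite} ^ ('n::finite + 'n)) set set" where
  "isotropic_codes k m =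
     {C. vec.subspace C \<and> symp_self_orthogonal C \<and> vec.dim C = k \<and> card (symp_dual C) = m}"

lemma isotropic_codes_image:
  assumes f: "symp_map f" and C: "C \<in> isotropic_codes k m"
  shows "f ` C \<in> isotropic_codes k m"
proof -
  have inj: "inj f" by (rule symp_map_inj[OF f])
  have surj: "surj f" using finite_UNIV_inj_surj[OF _ inj] by simp
  have lin: "Vector_Spaces.linear (*s) (*s) f" using f by (simp add: symp_map_def)
  have "vec.dim (f ` C) = vec.dim C"
    using vec.dim_image_eq[OF lin] inj by (metis inj_on_subset subset_UNIV)
  moreover have "vec.subspace (f ` C)"
    using vec.linear_subspace_image[OF lin] C by (simp add: isotropic_codes_def)
  ultimately show ?thesis
    using C card_image[OF inj_on_subset[OF inj subset_UNIV], of "symp_dual C"]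
    by (auto simp: isotropic_codes_def symp_self_orthogonal_def symp_dual_image[OF f surj])
qed

text \<open>A symplectic map taking \<open>w\<close> to \<open>w'\<close> induces an injection
  between the two sets of codes. Exchanging \<open>w\<close> and \<open>w'\<close> yields
  equality.\<close>

lemma card_isotropic_codes_le:
  fixes w w' :: "'a::{field,finite} ^ ('n::finite + 'n)"
  assumes "w \<noteq> 0" "w' \<noteq> 0"
  shows "card {C \<in> isotropic_codes k m. w \<in> symp_dual C}
    \<le> card {C \<in> isotropic_codes k m. w' \<in> symp_dual C}"
proof -
  obtain f where f: "symp_map f" "f w = w'" using ex_symp_map[OF assms] by blast
  have inj: "inj f" by (rule symp_map_inj[OF f(1)])
  have surj: "surj f" using finite_UNIV_inj_surj[OF _ inj] by simp
  show ?thesis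
  proof (rule card_inj_on_le)
    show "inj_on ((`) f) {C \<in> isotropic_codes k m. w \<in> symp_dual C}"
      using inj by (meson inj_image_eq_iff inj_onI)
    show "(`) f ` {C \<in> isotropic_codes k m. w \<in> symp_dual C}
        \<subseteq> {C \<in> isotropic_codes k m. w' \<in> symp_dual C}"
      using isotropic_codes_image[OF f(1)] symp_dual_image[OF f(1) surj] f(2) by auto
  qed simp
qed

text \<open>Count pairs of a nonzero \<open>v\<close> and a code whose dual contains
  \<open>v\<close>: each code contributes \<open>m - 1\<close>, and each \<open>v\<close>
  contributes as much as \<open>w\<close>.\<close>

lemma card_isotropic_codes_orthogonal:
  fixes w :: "'a::{field,finite} ^ ('n::finite + 'n)"
  assumes "w \<noteq> 0"
  shows "card {C \<in> isotropic_codes k m. w \<in> symp_dual C} * (CARD('a) ^ (2 * CARD('n)) - 1)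
    = card (isotropic_codes k m :: ('a ^ ('n + 'n)) set set) * (m - 1)"
proof -
  let ?I = "isotropic_codes k m :: ('a ^ ('n + 'n)) set set"
  let ?V = "UNIV - {0} :: ('a ^ ('n + 'n)) set"
  have "(\<Sum>v\<in>?V. card {C \<in> ?I. v \<in> symp_dual C}) = (\<Sum>C\<in>?I. card {v \<in> ?V. v \<in> symp_dual C})"
    by (rule sum_multicount_gen) simp_all
  also have "\<dots> = (\<Sum>C\<in>?I. m - 1)"
  proof (rule sum.cong)
    fix C assume "C \<in> ?I"
    moreover have "{v \<in> ?V. v \<in> symp_dual C} = symp_dual C - {0}" by auto
    moreover have "0 \<in> symp_dual C" by (simp add: symp_dual_def)
    ultimately show "card {v \<in> ?V. v \<in> symp_dual C} = m - 1"
      by (simp add: isotropic_codes_def)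
  qed simp
  finally have "(\<Sum>v\<in>?V. card {C \<in> ?I. v \<in> symp_dual C}) = card ?I * (m - 1)" by simp
  moreover have "(\<Sum>v\<in>?V. card {C \<in> ?I. v \<in> symp_dual C})
      = (\<Sum>v\<in>?V. card {C \<in> ?I. w \<in> symp_dual C})"
    using assms by (intro sum.cong) (auto intro: antisym card_isotropic_codes_le)
  moreover have "card ?V = CARD('a) ^ (2 * CARD('n)) - 1"
    by (simp add: card_Diff_subset mult_2)
  ultimately show ?thesis by (simp add: mult.commute)
qed

section \<open>Counting vectors by symplectic weight\<close>

lemma bij_vec_pairs:
  "bij (\<lambda>(v :: 'a ^ ('n::finite + 'n)) i. (v $ Inl i, v $ Inr i))"
proof (rule bijI)
  show "inj (\<lambda>(v :: 'a ^ ('n + 'n)) i. (v $ Inl i, v $ Inr i))"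
  proof (rule injI)
    fix v w :: "'a ^ ('n + 'n)"
    assume eq: "(\<lambda>i. (v $ Inl i, v $ Inr i)) = (\<lambda>i. (w $ Inl i, w $ Inr i))"
    have "v $ j = w $ j" for j by (cases j) (use eq in \<open>auto dest: fun_cong\<close>)
    then show "v = w" by (simp add: vec_eq_iff)
  qed
  show "surj (\<lambda>(v :: 'a ^ ('n + 'n)) i. (v $ Inl i, v $ Inr i))"
  proof (rule surjI)
    fix g :: "'n \<Rightarrow> 'a \<times> 'a"
    show "(\<lambda>i. ((\<chi> j. case j of Inl i \<Rightarrow> fst (g i) | Inr i \<Rightarrow> snd (g i)) $ Inl i,
        (\<chi> j. case j of Inl i \<Rightarrow> fst (g i) | Inr i \<Rightarrow> snd (g i)) $ Inr i)) = g"
      by simp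
  qed
qed

text \<open>Reading a vector as a function from positions to pairs turns conditions imposed position
  by position into a product of sets.\<close>

lemma card_vec_pairs:
  fixes A :: "'n::finite \<Rightarrow> ('a \<times> 'a) set"
  shows "card {v :: 'a ^ ('n + 'n). \<forall>i. (v $ Inl i, v $ Inr i) \<in> A i} = (\<Prod>i\<in>UNIV. card (A i))"
proof -
  have "card {v :: 'a ^ ('n + 'n). \<forall>i. (v $ Inl i, v $ Inr i) \<in> A i} = card (PiE UNIV A)"
  proof (rule bij_betw_same_card[OF bij_betw_subset[OF bij_vec_pairs]])
    let ?h = "\<lambda>(v :: 'a ^ ('n + 'n)) i. (v $ Inl i, v $ Inr i)"
    have "{v. \<forall>i. (v $ Inl i, v $ Inr i) \<in> A i} = ?h -` (PiE UNIV A)"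
      by (auto simp: PiE_UNIV_domain)
    then show "?h ` {v. \<forall>i. (v $ Inl i, v $ Inr i) \<in> A i} = PiE UNIV A"
      by (simp only: surj_image_vimage_eq[OF bij_is_surj[OF bij_vec_pairs]])
  qed simp
  then show ?thesis by (simp add: card_PiE)
qed

text \<open>Sort the vectors by support: each of the \<open>i\<close> positions in the support
  carries one of the \<open>q^2 - 1\<close> nonzero pairs.\<close>

lemma card_symp_weight:
  "card {v :: 'a::{zero,finite} ^ ('n::finite + 'n). symp_weight v = i}
    = (CARD('n) choose i) * (CARD('a) ^ 2 - 1) ^ i"
proof -
  define supp where "supp v = {i. (v $ Inl i, v $ Inr i) \<noteq> (0, 0)}" for v :: "'a ^ ('n + 'n)"
  have card_supp: "card {v. supp v = S} = (CARD('a) ^ 2 - 1) ^ card S" for S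
  proof -
    have "{v. supp v = S}
        = {v. \<forall>i. (v $ Inl i, v $ Inr i) \<in> (if i \<in> S then - {(0, 0)} else {(0, 0)})}"
      by (auto simp: supp_def)
    moreover have "card (- {(0 :: 'a, 0 :: 'a)}) = CARD('a) ^ 2 - 1"
      by (simp add: Compl_eq_Diff_UNIV card_Diff_subset power2_eq_square card_cartesian_product
          flip: UNIV_Times_UNIV)
    ultimately show ?thesis
      by (simp only: card_vec_pairs if_distrib[of card]) (simp add: prod.If_cases)
  qed
  have "{v :: 'a ^ ('n + 'n). symp_weight v = i} = (\<Union>S\<in>{S. card S = i}. {v. supp v = S})"
    by (auto simp: symp_weight_def supp_def left_half_def right_half_def)
  also have "card \<dots> = (\<Sum>S\<in>{S. card S = i}. card {v. supp v = S})"
    by (rule card_UN_disjoint) auto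
  also have "\<dots> = card {S :: 'n set. card S = i} * (CARD('a) ^ 2 - 1) ^ i"
    by (simp add: card_supp)
  also have "card {S :: 'n set. card S = i} = CARD('n) choose i"
    using n_subsets[of "UNIV :: 'n set" i] by simp
  finally show ?thesis .
qed

lemma symp_weight_eq_0_iff: "symp_weight v = 0 \<longleftrightarrow> v = 0"
proof
  assume "symp_weight v = 0"
  then have eq: "v $ Inl i = 0 \<and> v $ Inr i = 0" for i
    by (simp add: symp_weight_def left_half_def right_half_def)
  have "v $ j = 0" for j by (cases j) (simp_all add: eq)
  then show "v = 0" by (simp add: vec_eq_iff)
qed (simp add: symp_weight_def left_half_def right_half_def)

lemma card_symp_weight_less:
  "card {v :: 'a::{zero,finite} ^ ('n::finite + 'n). v \<noteq> 0 \<and> symp_weight v < d}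
    = (\<Sum>i=1..d-1. (CARD('n) choose i) * (CARD('a) ^ 2 - 1) ^ i)"
proof -
  have "{v :: 'a ^ ('n + 'n). v \<noteq> 0 \<and> symp_weight v < d}
      = (\<Union>i\<in>{1..d-1}. {v. symp_weight v = i})"
    by (auto simp flip: symp_weight_eq_0_iff)
  also have "card \<dots> = (\<Sum>i=1..d-1. card {v :: 'a ^ ('n + 'n). symp_weight v = i})"
    by (rule card_UN_disjoint) auto
  finally show ?thesis by (simp add: card_symp_weight)
qed

section \<open>An explicit member of the family\<close>

text \<open>The witness is spanned by the unit vectors \<open>axis (Inl i) 1\<close> with
  \<open>i\<close> in a \<open>k\<close>-set \<open>S\<close>. All its right halves vanish, so it is
  self-orthogonal.\<close>

lemma isotropic_codes_nonempty:
  assumes k: "k \<le> CARD('n::finite)"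
  shows "(isotropic_codes k (CARD('a) ^ (2 * CARD('n) - k))
    :: ('a::{field,finite} ^ ('n + 'n)) set set) \<noteq> {}"
proof -
  obtain S :: "'n set" where S: "card S = k"
    using obtain_subset_with_card_n[OF k] by blast
  define C :: "('a ^ ('n + 'n)) set" where "C = {v. \<forall>j. j \<notin> Inl ` S \<longrightarrow> v $ j = 0}"
  have dim: "vec.dim C = k"
    using S by (simp add: C_def dim_substandard_cart card_image)
  have sub: "vec.subspace C" by (auto simp: C_def vec.subspace_def)
  have dual: "symp_dual C = {v. \<forall>i\<in>S. v $ Inr i = 0}"
  proof (intro equalityI subsetI CollectI ballI)
    fix v i assume v: "v \<in> symp_dual C" and i: "i \<in> S"
    have "axis (Inl i) 1 \<in> C" using i by (auto simp: C_def axis_def)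
    then have "symp_prod v (axis (Inl i) 1) = 0" using v by (simp add: symp_dual_def)
    then show "v $ Inr i = 0" by (simp add: symp_prod_axis_Inl)
  next
    fix v :: "'a ^ ('n + 'n)" assume v: "v \<in> {v. \<forall>i\<in>S. v $ Inr i = 0}"
    have "symp_prod v c = 0" if "c \<in> C" for c
    proof -
      have "c $ Inr i = 0" "v $ Inr i * c $ Inl i = 0" for i
        using that v by (auto simp: C_def image_iff)
      then show ?thesis by (simp only: symp_prod_alt mult_zero_right sum.neutral_const diff_self)
    qed
    then show "v \<in> symp_dual C" by (simp add: symp_dual_def)
  qed
  \<comment> \<open>The \<open>k\<close> positions in \<open>S\<close> have \<open>q\<close>
    admissible pairs each and the other \<open>n - k\<close> have \<open>q^2\<close>, which gives
    \<open>q^(2n-k)\<close> in total.\<close>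
  have "symp_dual C
      = {v. \<forall>i. (v $ Inl i, v $ Inr i) \<in> (if i \<in> S then UNIV \<times> {0} else UNIV \<times> UNIV)}"
    by (auto simp: dual)
  then have "card (symp_dual C) = CARD('a) ^ k * (CARD('a) * CARD('a)) ^ (CARD('n) - k)"
    using S
    by (simp only: card_vec_pairs if_distrib[of card])
      (simp add: prod.If_cases card_cartesian_product card_Diff_subset Compl_eq_Diff_UNIV
        del: UNIV_Times_UNIV)
  also have "\<dots> = CARD('a) ^ (2 * CARD('n) - k)"
    using k by (simp add: power_mult_distrib mult_2 flip: power_add)
  finally have "C \<in> isotropic_codes k (CARD('a) ^ (2 * CARD('n) - k))"
    using sub dim
    by (auto simp: isotropic_codes_def symp_self_orthogonal_def dual) (auto simp: C_def)
  then show ?thesis by blast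
qed

section \<open>The numerical bound on the product quotient\<close>

text \<open>
  The factor \<open>1 + 2 / x ^ (2*n - 2*l - 1)\<close> makes the induction go through: relative to the
  right-hand quotient, step \<open>l + 1\<close> multiplies the product by at most
  \<open>1 + 1 / x ^ (2*n - 2*l - 3)\<close>.
\<close>
lemma prod_quotient_le_aux:
  fixes x :: real
  assumes x: "x \<ge> 2" and "Suc l \<le> n"
  shows "(\<Prod>i\<le>l. (x ^ (2*n - 2*i) - 1) / (x ^ (2*n - 2*i - 1) - 1))
    \<le> (x ^ (2*n) - 1) / (x ^ (2*n - Suc l) - 1) * (1 + 2 / x ^ (2*n - 2*l - 1))"
  using assms(2)
proof (induction l)
  case 0
  have "(x ^ (2*n) - 1) / (x ^ (2*n - 1) - 1) \<ge> 0" "x ^ (2*n - 1) \<ge> 0"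
    using x by (simp_all add: one_le_power)
  then have "(x ^ (2*n) - 1) / (x ^ (2*n - 1) - 1) * 1
      \<le> (x ^ (2*n) - 1) / (x ^ (2*n - 1) - 1) * (1 + 2 / x ^ (2*n - 1))"
    by (intro mult_left_mono) auto
  then show ?case by simp
next
  case (Suc l)
  define m where "m = 2*n - 2*l - 3"
  have m: "m \<ge> 1" "2*n - 2 * Suc l = Suc m" "2*n - 2 * Suc l - 1 = m" "2*n - 2*l - 1 = m + 2"
    "2*n - Suc l = Suc (m + Suc l)" "2*n - Suc (Suc l) = m + Suc l"
    using Suc.prems by (auto simp: m_def)
  define y where "y = x ^ m"
  define z where "z = x ^ (m + Suc l)"
  have pow: "x ^ (2*n - 2 * Suc l) = x * y" "x ^ (2*n - 2 * Suc l - 1) = y"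
    "x ^ (2*n - 2*l - 1) = y * x\<^sup>2" "x ^ (2*n - Suc l) = x * z" "x ^ (2*n - Suc (Suc l)) = z"
    unfolding m y_def z_def by (simp_all add: power_add power2_eq_square)
  have xy: "x \<le> y" using m(1) x power_increasing[of 1 m x] by (simp add: y_def)
  have yz: "y \<le> z" using x by (auto simp: y_def z_def simp del: power_Suc intro!: power_increasing)
  have T: "x ^ (2*n) - 1 \<ge> 0" using x by (simp add: one_le_power)
  \<comment> \<open>The new factor of the product costs \<open>x\<close> times a small correction;
    the inequality reduces to \<open>x \<le> y\<close>. The \<open>x\<close> is absorbed in
    \<open>B\<close>, where the exponent in the denominator drops by one.\<close>
  have A: "(x * y - 1) / (y - 1) \<le> x * (1 + 1 / y)"
  proof -
    have "(x * y - 1) * y \<le> x * (y + 1) * (y - 1)" using xy by (simp add: algebra_simps)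
    then show ?thesis using xy x by (simp add: field_simps)
  qed
  have B: "x / (x * z - 1) \<le> 1 / (z - 1)"
  proof -
    have "x * (z - 1) \<le> x * z - 1" using x by (simp add: algebra_simps)
    moreover have "z - 1 > 0" "x * z - 1 > 0"
      using x xy yz mult_mono[of 1 x 2 z] by linarith+
    ultimately show ?thesis by (simp add: field_simps)
  qed
  \<comment> \<open>The old and new corrections merge into the correction of the next step. This
    needs \<open>2 * y + 2 \<le> y * x\<^sup>2\<close>, which \<open>x \<ge> 2\<close> and
    \<open>y \<ge> 1\<close> provide.\<close>
  have D: "(1 + 2 / (y * x\<^sup>2)) * (1 + 1 / y) \<le> 1 + 2 / y"
  proof -
    have "x\<^sup>2 \<ge> 2\<^sup>2" using x by (intro power_mono) auto
    then have "y * x\<^sup>2 \<ge> y * 4" using xy x by (intro mult_left_mono) auto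
    then have "2 * y + 2 \<le> y * x\<^sup>2" using xy x by linarith
    then have "(2 * y + 2) / (y * y * x\<^sup>2) \<le> y * x\<^sup>2 / (y * y * x\<^sup>2)"
      using x xy by (intro divide_right_mono) auto
    then show ?thesis using x xy by (simp add: field_simps power2_eq_square)
  qed
  have "(\<Prod>i\<le>Suc l. (x ^ (2*n - 2*i) - 1) / (x ^ (2*n - 2*i - 1) - 1))
      \<le> (x ^ (2*n) - 1) / (x * z - 1) * (1 + 2 / (y * x\<^sup>2)) * ((x * y - 1) / (y - 1))"
  proof -
    have "(x * y - 1) / (y - 1) \<ge> 0" using x xy mult_mono[of 1 x 1 y] by simp
    moreover have "(\<Prod>i\<le>l. (x ^ (2*n - 2*i) - 1) / (x ^ (2*n - 2*i - 1) - 1))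
        \<le> (x ^ (2*n) - 1) / (x * z - 1) * (1 + 2 / (y * x\<^sup>2))"
      using Suc.IH[OF Suc_leD[OF Suc.prems]] by (simp only: pow)
    ultimately show ?thesis unfolding prod.atMost_Suc pow by (intro mult_right_mono)
  qed
  also have "\<dots> \<le> (x ^ (2*n) - 1) / (x * z - 1) * (1 + 2 / (y * x\<^sup>2)) * (x * (1 + 1 / y))"
  proof (rule mult_left_mono[OF A])
    show "0 \<le> (x ^ (2*n) - 1) / (x * z - 1) * (1 + 2 / (y * x\<^sup>2))"
      using T x xy yz mult_mono[of 1 x 1 z] by (intro mult_nonneg_nonneg) auto
  qed
  also have "\<dots> = (x ^ (2*n) - 1) * ((x / (x * z - 1)) * ((1 + 2 / (y * x\<^sup>2)) * (1 + 1 / y)))"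
    by simp
  also have "\<dots> \<le> (x ^ (2*n) - 1) * ((1 / (z - 1)) * (1 + 2 / y))"
    using T x xy yz by (intro mult_left_mono mult_mono B D) auto
  finally show ?case
    by (simp only: pow mult.assoc[symmetric] times_divide_eq_right mult_1_right)
qed

text \<open>The factor \<open>k\<close> in the denominator pays for the correction: the last
  exponent is at least 1, so the correction is at most 2, hence at most \<open>k\<close> when
  \<open>k \<ge> 2\<close>. For \<open>k = 1\<close> the product is the quotient itself.\<close>

lemma prod_quotient_le:
  fixes x :: real
  assumes x: "x \<ge> 2" and k: "1 \<le> k" "k \<le> n"
  shows "(\<Prod>i=0..k-1. (x ^ (2*n - 2*i) - 1)) / (real k * (\<Prod>i=0..k-1. (x ^ (2*n - 2*i - 1) - 1)))
    \<le> (x ^ (2*n) - 1) / (x ^ (2*n - k) - 1)"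
proof -
  let ?P = "\<Prod>i\<le>k-1. (x ^ (2*n - 2*i) - 1) / (x ^ (2*n - 2*i - 1) - 1)"
  let ?R = "(x ^ (2*n) - 1) / (x ^ (2*n - k) - 1)"
  have R: "?R \<ge> 0" using x by (simp add: one_le_power)
  have "?P \<le> ?R * real k"
  proof (cases "k = 1")
    case False
    have "x ^ 1 \<le> x ^ (2*n - 2*(k-1) - 1)"
      using x k by (intro power_increasing) auto
    then have "1 + 2 / x ^ (2*n - 2*(k-1) - 1) \<le> 2" using x by simp
    also have "\<dots> \<le> real k" using False k by simp
    finally have "?R * (1 + 2 / x ^ (2*n - 2*(k-1) - 1)) \<le> ?R * real k"
      using R by (rule mult_left_mono)
    then show ?thesis using prod_quotient_le_aux[OF x, of "k-1" n] k by simp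
  qed simp
  then have "?P / real k \<le> ?R" using k by (simp add: divide_le_eq)
  then show ?thesis by (simp add: prod_dividef atLeast0AtMost mult.commute)
qed

section \<open>The averaging argument\<close>

theorem corollary3p7:
  fixes q n k d :: nat
  assumes q: "q = CARD('a::{field,finite})"
    and n: "n = CARD('n::finite)"
    and k: "1 \<le> k" "k \<le> n"
    and d: "1 \<le> d"
    and bound:
      "(\<Sum>i=1..d-1. real (n choose i) * (real q ^ 2 - 1) ^ i)
         < (\<Prod>i=0..k-1. (real q ^ (2*n - 2*i) - 1))
             / (real k * (\<Prod>i=0..k-1. (real q ^ (2*n - 2*i - 1) - 1)))"
  shows "\<exists>C :: ('a ^ ('n + 'n)) set.
           vec.subspace C \<and> symp_self_orthogonal C \<and> vec.dim C = k \<and>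
           symp_min_dist (symp_dual C) \<ge> d"
proof -
  define m where "m = q ^ (2*n - k)"
  let ?I = "isotropic_codes k m :: ('a ^ ('n + 'n)) set set"
  define bad where "bad = {v :: 'a ^ ('n + 'n). v \<noteq> 0 \<and> symp_weight v < d}"
  have "card {0 :: 'a, 1} \<le> CARD('a)" by (rule card_mono) auto
  then have q2: "q \<ge> 2" by (simp add: q)
  have m1: "m > 1" using q2 k unfolding m_def by (intro one_less_power) auto
  have Q1: "q ^ (2*n) > 1" using q2 k by (intro one_less_power) auto
  have "real (card bad) = (\<Sum>i=1..d-1. real (n choose i) * (real q ^ 2 - 1) ^ i)"
    using q2 by (simp add: bad_def card_symp_weight_less n flip: q)
  also have "\<dots> < (real q ^ (2*n) - 1) / (real q ^ (2*n - k) - 1)"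
    using bound prod_quotient_le[of "real q" k n] q2 k by simp
  finally have "real (card bad) * (real m - 1) < real (q ^ (2*n)) - 1"
    using m1 by (subst (asm) pos_less_divide_eq)
      (simp_all only: m_def of_nat_power of_nat_1 diff_gt_0_iff_gt
        flip: of_nat_less_iff[where 'a = real])
  then have "real (card bad * (m - 1)) < real (q ^ (2*n) - 1)"
    using m1 Q1 by (simp add: of_nat_diff)
  \<comment> \<open>\<open>m > 1\<close> and \<open>q ^ (2*n) > 1\<close> ensure that truncated
    subtraction agrees with the real one.\<close>
  then have small: "card bad * (m - 1) < q ^ (2*n) - 1" by (simp only: of_nat_less_iff)
  have "\<exists>C\<in>?I. symp_dual C \<inter> bad = {}"
  proof (rule ccontr)
    assume "\<not> ?thesis"
    \<comment> \<open>If every dual meets \<open>bad\<close>, the union bound and the common count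
      per vector give \<open>card ?I * (q ^ (2*n) - 1) \<le> card ?I * (card bad * (m - 1))\<close>.
      By \<open>small\<close> the family would then be empty.\<close>
    then have cover: "?I \<subseteq> (\<Union>w\<in>bad. {C \<in> ?I. w \<in> symp_dual C})" by blast
    have "card ?I \<le> card (\<Union>w\<in>bad. {C \<in> ?I. w \<in> symp_dual C})"
      by (rule card_mono[OF _ cover]) simp
    also have "\<dots> \<le> (\<Sum>w\<in>bad. card {C \<in> ?I. w \<in> symp_dual C})"
      by (rule card_UN_le) simp
    finally have "card ?I * (q ^ (2*n) - 1)
        \<le> (\<Sum>w\<in>bad. card {C \<in> ?I. w \<in> symp_dual C} * (q ^ (2*n) - 1))"
      unfolding sum_distrib_right[symmetric] by (rule mult_le_mono1)
    also have "\<dots> = (\<Sum>w\<in>bad. card ?I * (m - 1))"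
      unfolding q n by (intro sum.cong card_isotropic_codes_orthogonal) (auto simp: bad_def)
    also have "\<dots> = card ?I * (card bad * (m - 1))" by simp
    finally have "card ?I = 0" using small by simp
    then show False
      using isotropic_codes_nonempty[of k, where 'a = 'a and 'n = 'n] k by (simp add: m_def q n)
  qed
  then obtain C where C: "C \<in> ?I" "symp_dual C \<inter> bad = {}" by blast
  have "card (symp_dual C) = m" using C(1) by (simp add: isotropic_codes_def)
  \<comment> \<open>A nonzero vector in the dual makes the set under \<open>Min\<close> nonempty, so
    that the minimum distance is meaningful.\<close>
  then have "symp_dual C \<noteq> {0}" using m1 by force
  moreover have "0 \<in> symp_dual C" by (simp add: symp_dual_def)
  ultimately have "symp_dual C - {0} \<noteq> {}" by blast
  moreover have "d \<le> symp_weight v" if "v \<in> symp_dual C - {0}" for v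
  proof (rule ccontr)
    assume "\<not> d \<le> symp_weight v"
    then have "v \<in> symp_dual C \<inter> bad" using that by (simp add: bad_def)
    then show False by (simp only: C(2) empty_iff)
  qed
  ultimately have "symp_min_dist (symp_dual C) \<ge> d"
    unfolding symp_min_dist_def by (subst Min_ge_iff) auto
  then show ?thesis using C(1) unfolding isotropic_codes_def by blast
qed

end
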